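(* Let $n\geq 1$ be an integer, $m=2n+1$, and $S_n=\{0\}\cup\{x\in\mathbb{Z}\mid x\ge 2m\}\cup\{m+2k \mid 0\leq k\leq n-1\}$. Then $S_n$ is a numerical semigroup with type $t(S_n)=n+1$ and $P(S_n)=2$, where $P(S_n)$ is the number of numerical sets $T$ with $A(T)=S_n$.
   Context: A numerical set $T$ is a subset of $\mathbb{N}_0=\{0,1,2,\dots\}$ containing $0$ with finite complement. A numerical semigroup is a numerical set closed under addition. The atom monoid of $T$ is $A(T)=\{x\in\mathbb{N}_0 \mid x+T\subseteq T\}$. The pseudo-Frobenius numbers of a numerical semigroup $S$ are $PF(S)=\{P\in \mathbb{N}_0\setminus S \mid P+s\in S \text{ for all } s\in S\setminus\{0\}\}$, and the type of $S$ is $t(S)=|PF(S)|$. *)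

theory Defs
  imports Main
begin

definition numerical_set :: "nat set \<Rightarrow> bool" where
  "numerical_set T \<longleftrightarrow> 0 \<in> T \<and> finite (- T)"

definition numerical_semigroup :: "nat set \<Rightarrow> bool" where
  "numerical_semigroup S \<longleftrightarrow> numerical_set S \<and> (\<forall>x\<in>S. \<forall>y\<in>S. x + y \<in> S)"

definition atom_monoid :: "nat set \<Rightarrow> nat set" where
  "atom_monoid T = {x. (\<lambda>t. x + t) ` T \<subseteq> T}"

definition pseudo_frobenius :: "nat set \<Rightarrow> nat set" where
  "pseudo_frobenius S = {P. P \<notin> S \<and> (\<forall>s\<in>S - {0}. P + s \<in> S)}"

definition semigroup_type :: "nat set \<Rightarrow> nat" where
  "semigroup_type S = card (pseudo_frobenius S)"

text \<open>The set counted here is finite for every numerical semigroup \<open>S\<close>: if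
  \<open>atom_monoid T = S\<close> and \<open>0 \<in> T\<close>, then \<open>S \<subseteq> T\<close>, and \<open>- S\<close> is finite.\<close>

definition num_associated_sets :: "nat set \<Rightarrow> nat" where
  "num_associated_sets S = card {T. numerical_set T \<and> atom_monoid T = S}"

text \<open>The integers \<open>x \<ge> 2m\<close> are nonnegative, so the set can be taken in \<open>nat\<close>; the bound
  \<open>k < n\<close> expresses \<open>0 \<le> k \<le> n - 1\<close> without truncated subtraction.\<close>

definition S_fam :: "nat \<Rightarrow> nat set" where
  "S_fam n = (let m = 2 * n + 1 in {0} \<union> {x. x \<ge> 2 * m} \<union> {m + 2 * k | k. k < n})"

end

theory Submission
  imports Defs
begin

text \<open>
  Put \<open>m = 2n + 1\<close> and \<open>F = 2m - 1 = 4n + 1\<close>, the Frobenius number of \<open>S = S_fam n\<close>. Apart from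
  \<open>0\<close>, the elements of \<open>S\<close> below \<open>F\<close> are the odd numbers in \<open>[m, F)\<close>. The pseudo-Frobenius
  numbers are \<open>F\<close> and the \<open>n\<close> even numbers in \<open>[m, F)\<close>.

  Let \<open>A(T) = S\<close>. Then \<open>S + T \<subseteq> T\<close> and \<open>F \<notin> T\<close>, so \<open>T\<close> contains no positive even number below
  \<open>m\<close>, because \<open>F\<close> minus such a number lies in \<open>S\<close>. If \<open>T\<close> has no positive element below \<open>m\<close>,
  every element of \<open>T\<close> is an atom and \<open>T = S\<close>. Otherwise \<open>T\<close> contains an odd number below \<open>m\<close>,
  hence \<open>4n \<in> T\<close>. An even \<open>x \<in> T\<close> in \<open>[m, F)\<close> is not an atom, which is only possible if
  \<open>F - x \<in> T\<close>. Thus \<open>1 \<in> T\<close>, so every even number in \<open>[m, F)\<close> is in \<open>1 + S \<subseteq> T\<close>, so every odd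
  number below \<open>m\<close> is in \<open>T\<close>, and \<open>T\<close> is determined.
\<close>

text \<open>Linear arithmetic with parity replaces the existential so that \<open>presburger\<close>
  can decide membership; the bound \<open>4 * n\<close> comes from
  \<open>m + 2 * (n - 1) = 4 * n - 1\<close>.\<close>

lemma mem_S_fam:
  "x \<in> S_fam n \<longleftrightarrow> x = 0 \<or> 4 * n + 2 \<le> x \<or> (odd x \<and> 2 * n + 1 \<le> x \<and> x < 4 * n)"
proof -
  have "(\<exists>k. x = 2 * n + 1 + 2 * k \<and> k < n) \<longleftrightarrow> odd x \<and> 2 * n + 1 \<le> x \<and> x < 4 * n"
    by presburger
  then show ?thesis
    by (auto simp: S_fam_def)
qed

lemma S_fam_add:
  assumes "x \<in> S_fam n" "y \<in> S_fam n"
  shows "x + y \<in> S_fam n"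
  using assms by (auto simp: mem_S_fam)

lemma numerical_semigroup_S_fam: "numerical_semigroup (S_fam n)"
proof -
  have "- S_fam n \<subseteq> {..<4 * n + 2}"
    by (auto simp: mem_S_fam)
  then have "finite (- S_fam n)"
    using finite_subset by blast
  then show ?thesis
    using S_fam_add by (auto simp: numerical_semigroup_def numerical_set_def mem_S_fam)
qed

lemma mem_pseudo_frobenius_S_fam:
  assumes "n \<ge> 1"
  shows "P \<in> pseudo_frobenius (S_fam n) \<longleftrightarrow>
    P = 4 * n + 1 \<or> (even P \<and> 2 * n + 1 \<le> P \<and> P \<le> 4 * n)" (is "_ \<longleftrightarrow> ?R")
proof
  assume P: "P \<in> pseudo_frobenius (S_fam n)"
  then have notin: "P \<notin> S_fam n"
    and add: "\<And>s. s \<in> S_fam n \<Longrightarrow> s \<noteq> 0 \<Longrightarrow> P + s \<in> S_fam n"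
    by (auto simp: pseudo_frobenius_def)
  show ?R
  proof (rule ccontr)
    assume "\<not> ?R"
    with notin have small: "0 < P" "P \<le> 2 * n"
      unfolding mem_S_fam by presburger+
    show False
    proof (cases "even P")
      case True
      \<comment> \<open>The reflection of \<open>P\<close> in F is odd and at least m; adding
        \<open>P\<close> gives F, a gap.\<close>
      have "4 * n + 1 - P \<in> S_fam n"
        using True small unfolding mem_S_fam by presburger
      from add[OF this] small show False
        unfolding mem_S_fam by presburger
    next
      case False
      \<comment> \<open>For odd \<open>P\<close>, the sum \<open>P + m\<close> is even and at most
        \<open>4 * n\<close>, again a gap.\<close>
      have "2 * n + 1 \<in> S_fam n"
        using assms unfolding mem_S_fam by presburger
      from add[OF this] small False show False
        unfolding mem_S_fam by presburger
    qed
  qed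
next
  assume R: ?R
  have "P + s \<in> S_fam n" if "s \<in> S_fam n" "s \<noteq> 0" for s
    \<comment> \<open>Both summands are at least m, so the sum is at least 2m.\<close>
    using R that by (auto simp: mem_S_fam)
  moreover have "P \<notin> S_fam n"
    using R unfolding mem_S_fam by presburger
  ultimately show "P \<in> pseudo_frobenius (S_fam n)"
    by (auto simp: pseudo_frobenius_def)
qed

lemma semigroup_type_S_fam:
  assumes "n \<ge> 1"
  shows "semigroup_type (S_fam n) = n + 1"
proof -
  have "(P = 4 * n + 1 \<or> (even P \<and> 2 * n + 1 \<le> P \<and> P \<le> 4 * n)) \<longleftrightarrow>
      P = 4 * n + 1 \<or> (\<exists>k<n. P = 2 * n + 2 + 2 * k)" for P
    by presburger
  then have "pseudo_frobenius (S_fam n) =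
      insert (4 * n + 1) ((\<lambda>k. 2 * n + 2 + 2 * k) ` {..<n})"
    using mem_pseudo_frobenius_S_fam[OF assms] by auto
  moreover have "card ((\<lambda>k. 2 * n + 2 + 2 * k) ` {..<n}) = n"
    by (simp add: card_image inj_on_def)
  moreover have "4 * n + 1 \<notin> (\<lambda>k. 2 * n + 2 + 2 * k) ` {..<n}"
    by auto presburger
  ultimately show ?thesis
    by (simp add: semigroup_type_def)
qed

lemma mem_atom_monoid: "x \<in> atom_monoid T \<longleftrightarrow> (\<forall>t\<in>T. x + t \<in> T)"
  by (auto simp: atom_monoid_def)

lemma atom_monoid_numerical_semigroup:
  assumes "numerical_semigroup S"
  shows "atom_monoid S = S"
proof -
  have "0 \<in> S" "\<And>x y. x \<in> S \<Longrightarrow> y \<in> S \<Longrightarrow> x + y \<in> S"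
    using assms by (auto simp: numerical_semigroup_def numerical_set_def)
  then show ?thesis
    using mem_atom_monoid by (metis add.right_neutral subsetI subset_antisym)
qed

text \<open>The second associated set: its gaps are exactly F and the positive even numbers below
  m.\<close>

definition T_fam :: "nat \<Rightarrow> nat set" where
  "T_fam n = S_fam n \<union> {x. odd x \<and> x \<le> 2 * n} \<union> {x. even x \<and> 2 * n + 1 \<le> x \<and> x \<le> 4 * n}"

lemma mem_T_fam:
  "x \<in> T_fam n \<longleftrightarrow> x = 0 \<or> 4 * n + 2 \<le> x \<or> (odd x \<and> x < 4 * n) \<or> (even x \<and> 2 * n + 1 \<le> x)"
  unfolding T_fam_def Un_iff mem_Collect_eq mem_S_fam by presburger

lemma numerical_set_T_fam: "numerical_set (T_fam n)"
proof -
  have "- T_fam n \<subseteq> {..<4 * n + 2}"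
    by (auto simp: mem_T_fam)
  then have "finite (- T_fam n)"
    using finite_subset by blast
  then show ?thesis
    by (simp add: numerical_set_def mem_T_fam)
qed

lemma atom_monoid_T_fam:
  assumes "n \<ge> 1"
  shows "atom_monoid (T_fam n) = S_fam n"
proof (intro equalityI subsetI)
  fix x
  assume "x \<in> S_fam n"
  then have "x + t \<in> T_fam n" if "t \<in> T_fam n" for t
    using that by (auto simp: mem_S_fam mem_T_fam)
  then show "x \<in> atom_monoid (T_fam n)"
    by (simp add: mem_atom_monoid)
next
  fix x
  assume "x \<in> atom_monoid (T_fam n)"
  then have add: "\<And>t. t \<in> T_fam n \<Longrightarrow> x + t \<in> T_fam n"
    by (simp add: mem_atom_monoid)
  have x: "x \<in> T_fam n"
    using add[of 0] by (simp add: mem_T_fam)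
  show "x \<in> S_fam n"
  proof (rule ccontr)
    assume "x \<notin> S_fam n"
    with x consider "odd x" "x \<le> 2 * n" | "even x" "2 * n + 1 \<le> x" "x \<le> 4 * n"
      by (auto simp: T_fam_def)
    then show False
    proof cases
      case 1
      then show False
        \<comment> \<open>Here \<open>x + 1\<close> is a positive even number below m, hence a
          gap.\<close>
        using add[of 1] assms unfolding mem_T_fam by presburger
    next
      case 2
      then have "4 * n + 1 - x \<in> T_fam n"
        unfolding mem_T_fam by presburger
      from add[OF this] 2 show False
        unfolding mem_T_fam by presburger
    qed
  qed
qed

lemma associated_set_S_fam:
  assumes "numerical_set T" and A: "atom_monoid T = S_fam n"
  shows "T = S_fam n \<or> T = T_fam n"
proof -
  have zero: "0 \<in> T"
    using assms(1) by (simp add: numerical_set_def)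
  have add: "s + t \<in> T" if "s \<in> S_fam n" "t \<in> T" for s t
    using that A mem_atom_monoid by blast
  have sub: "S_fam n \<subseteq> T"
    using add[OF _ zero] by auto
  have large: "x \<in> T" if "4 * n + 2 \<le> x" for x
    using sub that by (auto simp: mem_S_fam)
  have F: "4 * n + 1 \<notin> T"
  proof
    assume F: "4 * n + 1 \<in> T"
    \<comment> \<open>Any positive shift of F is at least 2m, so F in \<open>T\<close> would make F
      an atom.\<close>
    have "4 * n + 1 + t \<in> T" if "t \<in> T" for t
      using F large by (cases "t = 0") auto
    then have "4 * n + 1 \<in> S_fam n"
      using A mem_atom_monoid by blast
    then show False
      unfolding mem_S_fam by presburger
  qed
  have small_even: "x \<notin> T" if "even x" "0 < x" "x \<le> 2 * n" for x
  proof
    assume "x \<in> T"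
    moreover have "4 * n + 1 - x \<in> S_fam n"
      using that unfolding mem_S_fam by presburger
    ultimately have "4 * n + 1 - x + x \<in> T"
      using add by blast
    with F that show False by simp
  qed
  have reflect: "4 * n + 1 - x \<in> T" if x: "x \<in> T" "even x" "2 * n + 1 \<le> x" "x \<le> 4 * n" for x
  proof -
    have "x \<notin> S_fam n"
      using x unfolding mem_S_fam by presburger
    \<comment> \<open>As \<open>x + t\<close> is below 2m, \<open>t\<close> is below m and thus odd
      by \<open>small_even\<close>. So \<open>x + t\<close> is odd, at least m and outside S, which
      leaves only F.\<close>
    then obtain t where t: "t \<in> T" "x + t \<notin> T"
      using A mem_atom_monoid by blast
    have "t \<noteq> 0"
      using t x by (metis add.right_neutral)
    have lt: "x + t < 4 * n + 2"
      using large t(2) by (meson not_less)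
    then have "odd t"
      using small_even t(1) \<open>t \<noteq> 0\<close> x by fastforce
    then have "odd (x + t)"
      using x by simp
    moreover have "x + t \<notin> S_fam n"
      using t(2) sub by blast
    then have "\<not> x + t < 4 * n"
      using x \<open>odd (x + t)\<close> by (simp add: mem_S_fam)
    ultimately have "x + t = 4 * n + 1"
      using lt by presburger
    then have "4 * n + 1 - x = t"
      by simp
    with t show ?thesis by simp
  qed
  show ?thesis
  proof (cases "\<exists>x\<in>T. 0 < x \<and> x \<le> 2 * n")
    case False
    have "x \<in> S_fam n" if x: "x \<in> T" for x
    proof -
      have "x + t \<in> T" if "t \<in> T" for t
      proof (cases "x = 0 \<or> t = 0")
        case True
        then show ?thesis using x that by auto
      next
        case nonzero: False
        then have "2 * n < x" "2 * n < t"
          using False x that by (meson not_less not_gr_zero)+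
        then show ?thesis
          by (intro large) simp
      qed
      then show ?thesis
        using A mem_atom_monoid by blast
    qed
    with sub show ?thesis by blast
  next
    case True
    then obtain x where x: "x \<in> T" "0 < x" "x \<le> 2 * n"
      by blast
    then have odd: "odd x"
      using small_even by blast
    \<comment> \<open>An odd \<open>x\<close> below m makes \<open>4 * n - x\<close> odd and at
      least m.\<close>
    have "4 * n - x \<in> S_fam n"
      using x odd unfolding mem_S_fam by presburger
    from add[OF this x(1)] x have "4 * n \<in> T"
      by simp
    from reflect[OF this] x have one: "1 \<in> T"
      by simp
    have even: "y \<in> T" if y: "even y" "2 * n + 1 \<le> y" "y \<le> 4 * n" for y
    proof -
      have "y - 1 \<in> S_fam n"
        using y unfolding mem_S_fam by presburger
      from add[OF this one] y show ?thesis by simp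
    qed
    have odd: "y \<in> T" if y: "odd y" "y \<le> 2 * n" for y
    proof -
      have "even (4 * n + 1 - y)" "2 * n + 1 \<le> 4 * n + 1 - y" "4 * n + 1 - y \<le> 4 * n"
        using y by presburger+
      from reflect[OF even[OF this] this] y show ?thesis by simp
    qed
    have "T_fam n \<subseteq> T"
      using sub even odd by (auto simp: T_fam_def)
    moreover have "y \<in> T_fam n" if "y \<in> T" for y
    proof -
      have "y \<noteq> 4 * n + 1" "\<not> (even y \<and> 0 < y \<and> y \<le> 2 * n)"
        using that F small_even by blast+
      then show ?thesis
        unfolding mem_T_fam by presburger
    qed
    ultimately show ?thesis by blast
  qed
qed

lemma num_associated_sets_S_fam:
  assumes "n \<ge> 1"
  shows "num_associated_sets (S_fam n) = 2"
proof -
  have "numerical_set (S_fam n)"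
    using numerical_semigroup_S_fam by (simp add: numerical_semigroup_def)
  then have "{T. numerical_set T \<and> atom_monoid T = S_fam n} = {S_fam n, T_fam n}"
    using associated_set_S_fam atom_monoid_numerical_semigroup[OF numerical_semigroup_S_fam]
      numerical_set_T_fam atom_monoid_T_fam[OF assms] by auto
  moreover have "S_fam n \<noteq> T_fam n"
  proof -
    \<comment> \<open>For \<open>n \<ge> 1\<close>, the number 1 lies strictly between 0 and
      m.\<close>
    have "1 \<in> T_fam n" "1 \<notin> S_fam n"
      using assms by (auto simp: mem_T_fam mem_S_fam)
    then show ?thesis by blast
  qed
  ultimately show ?thesis
    by (simp add: num_associated_sets_def)
qed

theorem proposition8p1:
  fixes n :: nat
  assumes "n \<ge> 1"
  shows "numerical_semigroup (S_fam n) \<and> semigroup_type (S_fam n) = n + 1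
    \<and> num_associated_sets (S_fam n) = 2"
  using numerical_semigroup_S_fam semigroup_type_S_fam[OF assms]
    num_associated_sets_S_fam[OF assms] by blast

end
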